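(* Let $A$ be a coherent quantale with reticulation $(L(A),\lambda_A)$. Then: (1) for every $p\in \mathrm{Spec}(A)$, $O(p^{\ast})=(\tilde O(p))^{\ast}$; (2) for every prime ideal $P$ of $L(A)$, $(O(P))_{\ast}=\tilde O(P_{\ast})$.
   Context: A quantale is a complete lattice $(A,\vee,\wedge,0,1)$ with an associative multiplication distributing over arbitrary joins in each variable. All quantales are assumed commutative and integral ($1$ is the multiplicative unit). $K(A)$ is the set of compact elements. $A$ is algebraic if every element is a join of compact elements; $A$ is coherent if it is algebraic, $1\in K(A)$ and $K(A)$ is closed under multiplication. $a\rightarrow b=\bigvee\{x\in A: ax\le b\}$. An element $p<1$ is $m$-prime if $ab\le p$ implies $a\le p$ or $b\le p$; $\mathrm{Spec}(A)$ is the set of $m$-prime elements; $\rho(a)=\bigwedge\{p\in \mathrm{Spec}(A): a\le p\}$. The reticulation of a coherent quantale $A$ is the (unique up to isomorphism) bounded distributive lattice $L(A)$ together with a surjective map $\lambda_A:K(A)\to L(A)$ such that for all $a,b\in K(A)$: $\lambda_A(a\vee b)\le\lambda_A(a)\vee\lambda_A(b)$; $\lambda_A(ab)=\lambda_A(a)\wedge\lambda_A(b)$; $\lambda_A(a)\le\lambda_A(b)$ iff $a^n\le b$ for some integer $n\ge1$. For $a\in A$, $a^{\ast}=\{\lambda_A(c): c\in K(A),\ c\le a\}$, an ideal of $L(A)$; for an ideal $I$ of $L(A)$, $I_{\ast}=\bigvee\{c\in K(A):\lambda_A(c)\in I\}$. For $p\in \mathrm{Spec}(A)$, $p^{\ast}$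 is a prime ideal of $L(A)$; for a prime ideal $P$ of $L(A)$, $P_{\ast}\in \mathrm{Spec}(A)$. For $p\in \mathrm{Spec}(A)$, $\tilde O(p)=\bigvee\{c\in K(A): c\le p,\ c\rightarrow\rho(0)\not\le p\}$. For a prime ideal $P$ of a bounded distributive lattice $L$, $O(P)$ is the ideal $\{x\in L: x\wedge y=0\text{ for some } y\in L\setminus P\}$. *)

theory Defs
  imports Main
begin

context complete_lattice
begin

definition compact_element :: "'a \<Rightarrow> bool" where
  "compact_element c \<longleftrightarrow> (\<forall>S. c \<le> Sup S \<longrightarrow> (\<exists>F. finite F \<and> F \<subseteq> S \<and> c \<le> Sup F))"

end

(* The zero of the quantale is bot; integrality identifies the multiplicative unit with top. By
   commutativity, one distributive law gives both. The one-element quantale is not excluded. *)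
class comm_integral_quantale = complete_lattice + comm_monoid_mult +
  assumes mult_Sup_distrib: "a * Sup S = Sup ((*) a ` S)"
    and one_eq_top: "1 = top"

class coherent_quantale = comm_integral_quantale +
  assumes algebraic: "\<exists>S. (\<forall>c\<in>S. compact_element c) \<and> a = Sup S"
    and compact_one: "compact_element 1"
    and compact_mult: "compact_element a \<Longrightarrow> compact_element b \<Longrightarrow> compact_element (a * b)"

definition residual :: "'a::comm_integral_quantale \<Rightarrow> 'a \<Rightarrow> 'a" where
  "residual a b = Sup {x. a * x \<le> b}"

definition Spec :: "'a::comm_integral_quantale set" where
  "Spec = {p. p < 1 \<and> (\<forall>a b. a * b \<le> p \<longrightarrow> a \<le> p \<or> b \<le> p)}"

definition rho :: "'a::comm_integral_quantale \<Rightarrow> 'a" where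
  "rho a = Inf {p \<in> Spec. a \<le> p}"

definition O_tilde :: "'a::comm_integral_quantale \<Rightarrow> 'a" where
  "O_tilde p = Sup {c. compact_element c \<and> c \<le> p \<and> \<not> residual c (rho bot) \<le> p}"

definition lattice_ideal :: "'b::{distrib_lattice, bounded_lattice} set \<Rightarrow> bool" where
  "lattice_ideal I \<longleftrightarrow>
     bot \<in> I \<and> (\<forall>x\<in>I. \<forall>y. y \<le> x \<longrightarrow> y \<in> I) \<and> (\<forall>x\<in>I. \<forall>y\<in>I. sup x y \<in> I)"

definition prime_lattice_ideal :: "'b::{distrib_lattice, bounded_lattice} set \<Rightarrow> bool" where
  "prime_lattice_ideal P \<longleftrightarrow>
     lattice_ideal P \<and> P \<noteq> UNIV \<and> (\<forall>x y. inf x y \<in> P \<longrightarrow> x \<in> P \<or> y \<in> P)"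

definition O_ideal :: "'b::{distrib_lattice, bounded_lattice} set \<Rightarrow> 'b set" where
  "O_ideal P = {x. \<exists>y. y \<notin> P \<and> inf x y = bot}"

(* The reticulation map is defined on compact elements only: lam is a total function, but its
   values at non-compact arguments are arbitrary and never used. *)
definition reticulation ::
    "('a::coherent_quantale \<Rightarrow> 'b::{distrib_lattice, bounded_lattice}) \<Rightarrow> bool" where
  "reticulation lam \<longleftrightarrow>
     lam ` {c. compact_element c} = UNIV \<and>
     (\<forall>a b. compact_element a \<longrightarrow> compact_element b \<longrightarrow>
        lam (sup a b) \<le> sup (lam a) (lam b) \<and>
        lam (a * b) = inf (lam a) (lam b) \<and>
        (lam a \<le> lam b \<longleftrightarrow> (\<exists>n\<ge>1. a ^ n \<le> b)))"

definition upper_star ::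
    "('a::coherent_quantale \<Rightarrow> 'b::{distrib_lattice, bounded_lattice}) \<Rightarrow> 'a \<Rightarrow> 'b set" where
  "upper_star lam a = {lam c | c. compact_element c \<and> c \<le> a}"

definition lower_star ::
    "('a::coherent_quantale \<Rightarrow> 'b::{distrib_lattice, bounded_lattice}) \<Rightarrow> 'b set \<Rightarrow> 'a" where
  "lower_star lam I = Sup {c. compact_element c \<and> lam c \<in> I}"

end

theory Submission
  imports Defs
begin

text \<open>For prime \<open>p\<close> and compact \<open>c\<close>, one has \<open>c \<le> p\<close> iff \<open>lam c\<close> lies in \<open>p\<^sup>*\<close>. A compact element
  lies below the radical of zero iff it is nilpotent (Zorn), that is, iff \<open>lam\<close> sends it to zero.
  Since a residual is a join of compact elements, the generators of \<open>O_tilde p\<close> are exactly the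
  compact \<open>c\<close> with \<open>lam c\<close> in \<open>O(p\<^sup>*)\<close>; hence \<open>O_tilde p = O(p\<^sup>*)\<^sub>*\<close>. Both claims follow because
  \<open>(I\<^sub>*)\<^sup>* = I\<close> for every lattice ideal \<open>I\<close>.\<close>

section \<open>Compact elements\<close>

lemma compact_bot: "compact_element (bot :: 'a::complete_lattice)"
  unfolding compact_element_def by (metis bot_least empty_subsetI finite.emptyI)

lemma compact_sup:
  fixes a b :: "'a::complete_lattice"
  assumes "compact_element a" "compact_element b"
  shows "compact_element (sup a b)"
  unfolding compact_element_def
proof (intro allI impI)
  fix S assume "sup a b \<le> Sup S"
  then have "a \<le> Sup S" "b \<le> Sup S" by auto
  then obtain F G where "finite F" "F \<subseteq> S" "a \<le> Sup F" "finite G" "G \<subseteq> S" "b \<le> Sup G"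
    using assms unfolding compact_element_def by meson
  then show "\<exists>F. finite F \<and> F \<subseteq> S \<and> sup a b \<le> Sup F"
    by (intro exI[of _ "F \<union> G"]) (auto simp: Sup_union_distrib intro: le_supI1 le_supI2)
qed

lemma compact_Sup_finite:
  fixes F :: "'a::complete_lattice set"
  assumes "finite F" "\<And>c. c \<in> F \<Longrightarrow> compact_element c"
  shows "compact_element (Sup F)"
  using assms by (induction F) (auto intro: compact_bot compact_sup)

text \<open>Compactness replaces the chain by a finite part, and a finite part of a nonempty chain
  is bounded by a member of the chain. This supplies the upper bounds for Zorn's lemma.\<close>

lemma compact_le_chain_Sup:
  fixes c :: "'a::complete_lattice"
  assumes c: "compact_element c" and chain: "\<And>x y. x \<in> C \<Longrightarrow> y \<in> C \<Longrightarrow> x \<le> y \<or> y \<le> x"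
    and "C \<noteq> {}" "c \<le> Sup C"
  shows "\<exists>x\<in>C. c \<le> x"
proof -
  obtain F where F: "finite F" "F \<subseteq> C" "c \<le> Sup F"
    using assms unfolding compact_element_def by meson
  have "\<exists>x\<in>C. Sup F \<le> x"
    using F(1,2)
  proof (induction F)
    case empty
    then show ?case using \<open>C \<noteq> {}\<close> by auto
  next
    case (insert y F)
    then obtain x where "x \<in> C" "Sup F \<le> x" by auto
    then show ?case using chain[of x y] insert.prems by (auto intro: order_trans)
  qed
  then show ?thesis using F(3) order_trans by blast
qed

lemma compact_power:
  fixes c :: "'a::coherent_quantale"
  shows "compact_element c \<Longrightarrow> compact_element (c ^ n)"
  by (induction n) (auto intro: compact_one compact_mult)

section \<open>Multiplication and residuals in a quantale\<close>

lemma mult_sup_distrib: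
  fixes a b c :: "'a::comm_integral_quantale"
  shows "a * sup b c = sup (a * b) (a * c)"
  using mult_Sup_distrib[of a "{b, c}"] by simp

lemma quantale_mult_mono:
  fixes a b c d :: "'a::comm_integral_quantale"
  assumes "a \<le> b" "c \<le> d"
  shows "a * c \<le> b * d"
proof -
  have left: "x * y \<le> x * z" if "y \<le> z" for x y z :: 'a
    using mult_sup_distrib[of x y z] that by (metis sup.absorb2 sup.cobounded1)
  show ?thesis
    using left[OF assms(2), of a] left[OF assms(1), of d] by (metis mult.commute order_trans)
qed

lemma le_one:
  fixes a :: "'a::comm_integral_quantale"
  shows "a \<le> 1"
  by (simp add: one_eq_top)

lemma mult_le_left:
  fixes a b :: "'a::comm_integral_quantale"
  shows "a * b \<le> a"
  using quantale_mult_mono[OF order_refl le_one, of a b] by simp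

lemma mult_le_right:
  fixes a b :: "'a::comm_integral_quantale"
  shows "a * b \<le> b"
  using mult_le_left[of b a] by (simp add: mult.commute)

text \<open>After expansion every term except \<open>a * b\<close> has \<open>p\<close> as a factor.
  This is what makes a maximal element in the Zorn argument m-prime.\<close>

lemma mult_sup_sup_le:
  fixes p a b :: "'a::comm_integral_quantale"
  shows "sup p a * sup p b \<le> sup p (a * b)"
proof -
  have "sup p a * sup p b = sup (sup p a * p) (sup (b * p) (a * b))"
    by (metis mult.commute mult_sup_distrib)
  then show ?thesis
    by (metis le_supI le_supI1 mult_le_right sup.cobounded2)
qed

lemma le_residual_iff:
  fixes a b :: "'a::comm_integral_quantale"
  shows "x \<le> residual a b \<longleftrightarrow> a * x \<le> b"
proof
  assume "x \<le> residual a b"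
  then have "a * x \<le> a * residual a b" by (simp add: quantale_mult_mono)
  also have "\<dots> \<le> b"
    unfolding residual_def mult_Sup_distrib by (auto intro: Sup_least)
  finally show "a * x \<le> b" .
qed (auto simp: residual_def intro: Sup_upper)

lemma not_le_compactE:
  fixes a b :: "'a::coherent_quantale"
  assumes "\<not> a \<le> b"
  obtains c where "compact_element c" "c \<le> a" "\<not> c \<le> b"
proof -
  obtain S where "\<forall>c\<in>S. compact_element c" "a = Sup S" using algebraic by blast
  then show thesis using that assms by (metis Sup_least Sup_upper)
qed

section \<open>The m-prime elements and the radical of zero\<close>

lemma Spec_mult_le_iff:
  assumes "p \<in> Spec"
  shows "a * b \<le> p \<longleftrightarrow> a \<le> p \<or> b \<le> p"
  using assms mult_le_left mult_le_right unfolding Spec_def by (blast intro: order_trans)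

lemma Spec_not_one_le: "p \<in> Spec \<Longrightarrow> \<not> 1 \<le> p"
  unfolding Spec_def by auto

text \<open>Exponent zero is harmless: the premise would then put \<open>1\<close> below a
  prime.\<close>

lemma Spec_power_leD: "p \<in> Spec \<Longrightarrow> a ^ n \<le> p \<Longrightarrow> a \<le> p"
  by (induction n) (auto simp: Spec_mult_le_iff Spec_not_one_le)

text \<open>An element maximal among those lying above no power of \<open>c\<close> is
  m-prime.\<close>

lemma Spec_avoiding_powers:
  fixes c :: "'a::coherent_quantale"
  assumes c: "compact_element c" and nil: "\<And>n. \<not> c ^ n \<le> bot"
  shows "\<exists>p\<in>Spec. \<not> c \<le> p"
proof -
  define X where "X = {a. \<forall>n. \<not> c ^ n \<le> a}"
  have "\<exists>m\<in>X. \<forall>a\<in>X. m \<le> a \<longrightarrow> a = m"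
  proof (rule predicate_Zorn)
    show "partial_order_on X (relation_of (\<le>) X)"
      by (rule partial_order_on_relation_ofI) auto
  next
    fix C assume C: "C \<in> Chains (relation_of (\<le>) X)"
    then have sub: "C \<subseteq> X" and chain: "\<And>x y. x \<in> C \<Longrightarrow> y \<in> C \<Longrightarrow> x \<le> y \<or> y \<le> x"
      unfolding Chains_def relation_of_def by auto
    show "\<exists>u\<in>X. \<forall>a\<in>C. a \<le> u"
    proof (cases "C = {}")
      case True
      then show ?thesis using nil X_def by auto
    next
      case False
      \<comment> \<open>The powers of \<open>c\<close> are compact, so a power below
        \<open>Sup C\<close> would already lie below a member of \<open>C\<close>.\<close>
      have "Sup C \<in> X"
        using compact_le_chain_Sup[OF compact_power[OF c] chain False] sub
        unfolding X_def by blast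
      then show ?thesis by (auto intro: Sup_upper)
    qed
  qed
  then obtain p where p: "p \<in> X" and max: "\<And>a. a \<in> X \<Longrightarrow> p \<le> a \<Longrightarrow> a = p" by blast
  have "\<not> a * b \<le> p" if "\<not> a \<le> p" "\<not> b \<le> p" for a b
  proof
    assume ab: "a * b \<le> p"
    \<comment> \<open>Both joins are strictly above \<open>p\<close>, so by maximality each lies
      above some power of \<open>c\<close>; multiplying these adds the exponents.\<close>
    have "sup p a \<notin> X" "sup p b \<notin> X"
      using max[of "sup p a"] max[of "sup p b"] that by (metis sup.cobounded1 sup.cobounded2)+
    then obtain m n where "c ^ m \<le> sup p a" "c ^ n \<le> sup p b" unfolding X_def by auto
    then have "c ^ (m + n) \<le> sup p (a * b)"
      unfolding power_add by (meson mult_sup_sup_le order_trans quantale_mult_mono)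
    then show False using ab p unfolding X_def by (simp add: sup.absorb1)
  qed
  \<comment> \<open>These are the exponents 0 and 1 in the definition of \<open>X\<close>.\<close>
  moreover have "\<not> 1 \<le> p" "\<not> c \<le> p"
    using p unfolding X_def by (metis (mono_tags) mem_Collect_eq power_0 power_one_right)+
  ultimately show ?thesis
    unfolding Spec_def using le_one by (auto simp: less_le_not_le)
qed

lemma rho_bot_le: "p \<in> Spec \<Longrightarrow> rho bot \<le> p"
  unfolding rho_def by (auto intro: Inf_lower)

lemma compact_le_rho_bot_iff:
  fixes c :: "'a::coherent_quantale"
  assumes "compact_element c"
  shows "c \<le> rho bot \<longleftrightarrow> (\<exists>n\<ge>1. c ^ n \<le> bot)"
proof
  assume c: "c \<le> rho bot"
  have "\<exists>n. c ^ n \<le> bot"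
    using Spec_avoiding_powers[OF assms] c rho_bot_le order_trans by blast
  then obtain n where "c ^ n \<le> bot" ..
  \<comment> \<open>The exponent found may be 0, while the claim asks for at least 1.\<close>
  then have "c ^ Suc n \<le> bot" by (metis mult_le_right order_trans power_Suc)
  then show "\<exists>n\<ge>1. c ^ n \<le> bot" by (intro exI[of _ "Suc n"]) auto
next
  assume "\<exists>n\<ge>1. c ^ n \<le> bot"
  then obtain n where "c ^ n \<le> bot" by blast
  then have "c \<le> p" if "p \<in> Spec" for p
    using Spec_power_leD[OF that] order_trans[OF _ bot_least] by blast
  then show "c \<le> rho bot"
    unfolding rho_def by (auto intro: Inf_greatest)
qed

section \<open>The ideal \<open>O_ideal P\<close> of a distributive lattice\<close>

lemma O_ideal_ideal:
  assumes "prime_lattice_ideal P"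
  shows "lattice_ideal (O_ideal P)"
  unfolding lattice_ideal_def
proof (intro conjI ballI allI impI)
  show "bot \<in> O_ideal P"
    using assms unfolding prime_lattice_ideal_def O_ideal_def by auto
next
  fix x y assume "x \<in> O_ideal P" "y \<le> x"
  then obtain u where u: "u \<notin> P" "inf x u = bot" unfolding O_ideal_def by auto
  have "inf y u \<le> inf x u" using \<open>y \<le> x\<close> by (simp add: le_infI1)
  then show "y \<in> O_ideal P" using u bot_unique unfolding O_ideal_def by auto
next
  fix x y assume "x \<in> O_ideal P" "y \<in> O_ideal P"
  then obtain u v where uv: "u \<notin> P" "v \<notin> P" "inf x u = bot" "inf y v = bot"
    unfolding O_ideal_def by auto
  \<comment> \<open>Primeness keeps the meet of the two witnesses outside \<open>P\<close>, and this
    meet annihilates both \<open>x\<close> and \<open>y\<close>.\<close>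
  have "inf u v \<notin> P" using uv assms unfolding prime_lattice_ideal_def by blast
  moreover have "inf x (inf u v) = bot" "inf y (inf u v) = bot"
    using uv by (simp_all add: inf.assoc[symmetric]) (simp add: inf.assoc inf.left_commute)
  ultimately show "sup x y \<in> O_ideal P"
    unfolding O_ideal_def by (auto simp: inf_sup_distrib2)
qed

section \<open>The reticulation and the two star maps\<close>

context
  fixes lam :: "'a::coherent_quantale \<Rightarrow> 'b::{distrib_lattice, bounded_lattice}"
  assumes ret: "reticulation lam"
begin

lemma lam_surjE: obtains c where "compact_element c" "lam c = x"
  using ret unfolding reticulation_def by (metis (mono_tags) UNIV_I imageE mem_Collect_eq)

lemma lam_sup_le:
  "compact_element a \<Longrightarrow> compact_element b \<Longrightarrow> lam (sup a b) \<le> sup (lam a) (lam b)"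
  using ret unfolding reticulation_def by blast

lemma lam_mult:
  "compact_element a \<Longrightarrow> compact_element b \<Longrightarrow> lam (a * b) = inf (lam a) (lam b)"
  using ret unfolding reticulation_def by blast

lemma lam_le_iff:
  "compact_element a \<Longrightarrow> compact_element b \<Longrightarrow> lam a \<le> lam b \<longleftrightarrow> (\<exists>n\<ge>1. a ^ n \<le> b)"
  using ret unfolding reticulation_def by blast

lemma lam_mono: "compact_element a \<Longrightarrow> compact_element b \<Longrightarrow> a \<le> b \<Longrightarrow> lam a \<le> lam b"
  using lam_le_iff by (metis order_refl power_one_right)

lemma lam_bot: "lam bot = bot"
  by (metis bot_least bot_unique compact_bot lam_mono lam_surjE)

lemma lam_one: "lam 1 = top"
  by (metis compact_one lam_mono lam_surjE le_one top_unique)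

text \<open>Both sides say that \<open>c\<close> is nilpotent: one by comparing \<open>lam c\<close>
  with \<open>lam bot\<close>, the other by \<open>compact_le_rho_bot_iff\<close>.\<close>

lemma lam_eq_bot_iff: "compact_element c \<Longrightarrow> lam c = bot \<longleftrightarrow> c \<le> rho bot"
  using lam_le_iff[OF _ compact_bot] compact_le_rho_bot_iff by (metis bot_unique lam_bot)

text \<open>As \<open>lam\<close> need not be injective, membership only yields some compact
  \<open>e\<close> below \<open>p\<close> with the same image; then a power of \<open>c\<close> is
  below \<open>e\<close>, and primeness removes the exponent.\<close>

lemma lam_mem_upper_star_iff:
  assumes "p \<in> Spec" "compact_element c"
  shows "lam c \<in> upper_star lam p \<longleftrightarrow> c \<le> p"
proof
  assume "lam c \<in> upper_star lam p"
  then obtain e where "lam c = lam e" "compact_element e" "e \<le> p"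
    unfolding upper_star_def by auto
  then show "c \<le> p"
    using assms lam_le_iff by (metis Spec_power_leD order_refl order_trans)
qed (use assms in \<open>auto simp: upper_star_def\<close>)

lemma upper_star_prime:
  assumes p: "p \<in> Spec"
  shows "prime_lattice_ideal (upper_star lam p)"
  unfolding prime_lattice_ideal_def lattice_ideal_def
proof (intro conjI ballI allI impI)
  note mem = lam_mem_upper_star_iff[OF p]
  show "bot \<in> upper_star lam p"
    using mem[OF compact_bot] by (simp add: lam_bot)
  show "upper_star lam p \<noteq> UNIV"
    using mem[OF compact_one] Spec_not_one_le[OF p] by auto
  show down: "y \<in> upper_star lam p" if xy: "x \<in> upper_star lam p" "y \<le> x" for x y
  proof -
    obtain a b where ab: "compact_element a" "lam a = x" "compact_element b" "lam b = y"
      by (meson lam_surjE)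
    then have "a \<le> p" using xy mem by blast
    moreover obtain n where "b ^ n \<le> a"
      using lam_le_iff[OF ab(3,1)] ab xy by auto
    ultimately have "b \<le> p" using Spec_power_leD[OF p] order_trans by blast
    then show ?thesis using ab mem by blast
  qed
  show "sup x y \<in> upper_star lam p" if xy: "x \<in> upper_star lam p" "y \<in> upper_star lam p" for x y
  proof -
    obtain a b where ab: "compact_element a" "lam a = x" "compact_element b" "lam b = y"
      by (meson lam_surjE)
    have s: "compact_element (sup a b)" using ab compact_sup by blast
    have "a \<le> p" "b \<le> p" using xy ab mem by auto
    then have "lam (sup a b) \<in> upper_star lam p" using mem[OF s] by simp
    \<comment> \<open>Monotonicity alone gives this direction, and downward closure then
      finishes.\<close>
    moreover have "sup x y \<le> lam (sup a b)"
      using lam_mono[OF ab(1) s] lam_mono[OF ab(3) s] ab by simp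
    ultimately show ?thesis using down by blast
  qed
  show "x \<in> upper_star lam p \<or> y \<in> upper_star lam p" if "inf x y \<in> upper_star lam p" for x y
  proof -
    obtain a b where ab: "compact_element a" "lam a = x" "compact_element b" "lam b = y"
      by (meson lam_surjE)
    then have "a * b \<le> p" using that mem[OF compact_mult] lam_mult by metis
    then show ?thesis using ab mem Spec_mult_le_iff[OF p] by blast
  qed
qed

text \<open>Compactness cuts the join defining \<open>lower_star\<close> down to a finite one, whose
  image lies below a finite join of members of \<open>I\<close>.\<close>

lemma compact_le_lower_star_iff:
  assumes I: "lattice_ideal I" and c: "compact_element c"
  shows "c \<le> lower_star lam I \<longleftrightarrow> lam c \<in> I"
proof
  assume "c \<le> lower_star lam I"
  then obtain F where F: "finite F" "F \<subseteq> {c. compact_element c \<and> lam c \<in> I}" "c \<le> Sup F"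
    using c unfolding lower_star_def compact_element_def by meson
  have "lam (Sup F) \<in> I" using F(1,2)
  proof (induction F)
    case empty
    then show ?case using I by (simp add: lam_bot lattice_ideal_def)
  next
    case (insert x F)
    then have "lam (sup x (Sup F)) \<le> sup (lam x) (lam (Sup F))"
      by (intro lam_sup_le compact_Sup_finite) auto
    moreover have "sup (lam x) (lam (Sup F)) \<in> I"
      using insert I unfolding lattice_ideal_def by auto
    ultimately show ?case using I unfolding lattice_ideal_def by auto
  qed
  moreover have "lam c \<le> lam (Sup F)"
    using F by (intro lam_mono c compact_Sup_finite) auto
  ultimately show "lam c \<in> I" using I unfolding lattice_ideal_def by blast
qed (use c in \<open>auto simp: lower_star_def intro: Sup_upper\<close>)

lemma upper_lower_star:
  assumes "lattice_ideal I"
  shows "upper_star lam (lower_star lam I) = I"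
proof (intro set_eqI)
  fix x
  obtain c where "compact_element c" "lam c = x" by (rule lam_surjE)
  then show "x \<in> upper_star lam (lower_star lam I) \<longleftrightarrow> x \<in> I"
    using compact_le_lower_star_iff[OF assms] unfolding upper_star_def by auto
qed

text \<open>By algebraicity, primeness can be tested on compact elements, where it becomes primeness
  of \<open>P\<close> through \<open>lam\<close>.\<close>

lemma lower_star_Spec:
  assumes P: "prime_lattice_ideal P"
  shows "lower_star lam P \<in> Spec"
proof -
  have I: "lattice_ideal P" using P unfolding prime_lattice_ideal_def by auto
  note mem = compact_le_lower_star_iff[OF I]
  have "top \<notin> P" using P unfolding prime_lattice_ideal_def lattice_ideal_def by auto
  then have "\<not> 1 \<le> lower_star lam P" using mem[OF compact_one] by (simp add: lam_one)
  moreover have "\<not> a * b \<le> lower_star lam P"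
    if ab: "\<not> a \<le> lower_star lam P" "\<not> b \<le> lower_star lam P" for a b
  proof
    assume le: "a * b \<le> lower_star lam P"
    obtain c where c: "compact_element c" "c \<le> a" "\<not> c \<le> lower_star lam P"
      using not_le_compactE[OF ab(1)] .
    obtain d where d: "compact_element d" "d \<le> b" "\<not> d \<le> lower_star lam P"
      using not_le_compactE[OF ab(2)] .
    have "c * d \<le> lower_star lam P" using le quantale_mult_mono[OF c(2) d(2)] by auto
    then have "inf (lam c) (lam d) \<in> P"
      using mem[OF compact_mult] c d lam_mult by metis
    then show False using P c d mem unfolding prime_lattice_ideal_def by blast
  qed
  ultimately show ?thesis
    unfolding Spec_def using le_one by (auto simp: less_le_not_le)
qed

text \<open>A witness on either side is a compact \<open>d\<close> not below \<open>p\<close> with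
  \<open>c * d\<close> below \<open>rho bot\<close>; under \<open>lam\<close> the latter becomes a
  zero meet.\<close>

lemma not_residual_le_iff:
  assumes p: "p \<in> Spec" and c: "compact_element c"
  shows "\<not> residual c (rho bot) \<le> p \<longleftrightarrow> lam c \<in> O_ideal (upper_star lam p)"
proof
  assume "\<not> residual c (rho bot) \<le> p"
  then obtain d where d: "compact_element d" "d \<le> residual c (rho bot)" "\<not> d \<le> p"
    by (rule not_le_compactE)
  then have "inf (lam c) (lam d) = bot"
    using c lam_eq_bot_iff[OF compact_mult] lam_mult le_residual_iff by metis
  then show "lam c \<in> O_ideal (upper_star lam p)"
    unfolding O_ideal_def using lam_mem_upper_star_iff[OF p] d by auto
next
  assume "lam c \<in> O_ideal (upper_star lam p)"
  then obtain d where d: "compact_element d" "lam d \<notin> upper_star lam p" "inf (lam c) (lam d) = bot"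
    unfolding O_ideal_def using lam_surjE by (smt (verit) mem_Collect_eq)
  then have "d \<le> residual c (rho bot)"
    using c lam_eq_bot_iff[OF compact_mult] lam_mult le_residual_iff by metis
  then show "\<not> residual c (rho bot) \<le> p"
    using d lam_mem_upper_star_iff[OF p] order_trans by blast
qed

lemma O_tilde_eq_lower_star:
  assumes p: "p \<in> Spec"
  shows "O_tilde p = lower_star lam (O_ideal (upper_star lam p))"
proof -
  \<comment> \<open>The product of \<open>c\<close> with its residual lies below
    \<open>rho bot\<close>, hence below \<open>p\<close>, and primeness leaves only
    \<open>c\<close>.\<close>
  have "c \<le> p" if "\<not> residual c (rho bot) \<le> p" for c
    using that Spec_mult_le_iff[OF p] le_residual_iff rho_bot_le[OF p] order_trans
    by (metis order_refl)
  then have "{c. compact_element c \<and> c \<le> p \<and> \<not> residual c (rho bot) \<le> p}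
      = {c. compact_element c \<and> lam c \<in> O_ideal (upper_star lam p)}"
    using not_residual_le_iff[OF p] by blast
  then show ?thesis unfolding O_tilde_def lower_star_def by simp
qed

end

theorem theorem4p19:
  fixes lam :: "'a::coherent_quantale \<Rightarrow> 'b::{distrib_lattice, bounded_lattice}"
  assumes "reticulation lam"
  shows "(\<forall>p\<in>Spec. O_ideal (upper_star lam p) = upper_star lam (O_tilde p)) \<and>
         (\<forall>P. prime_lattice_ideal P \<longrightarrow> lower_star lam (O_ideal P) = O_tilde (lower_star lam P))"
proof (intro conjI ballI allI impI)
  fix p :: 'a assume p: "p \<in> Spec"
  show "O_ideal (upper_star lam p) = upper_star lam (O_tilde p)"
    using upper_lower_star[OF assms O_ideal_ideal[OF upper_star_prime[OF assms p]]]
    by (simp add: O_tilde_eq_lower_star[OF assms p])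
next
  fix P :: "'b set" assume P: "prime_lattice_ideal P"
  \<comment> \<open>Since \<open>P\<close> is recovered from the prime element
    \<open>lower_star lam P\<close>, the second claim is \<open>O_tilde_eq_lower_star\<close> at
    that element.\<close>
  then have "upper_star lam (lower_star lam P) = P"
    using upper_lower_star[OF assms] unfolding prime_lattice_ideal_def by blast
  then show "lower_star lam (O_ideal P) = O_tilde (lower_star lam P)"
    using O_tilde_eq_lower_star[OF assms lower_star_Spec[OF assms P]] by simp
qed

end
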